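(* There exists a constant $C>0$ such that for every positive integer $n$ there exist 3-SAT formulas $f$ and $\tilde f$, each with at most $Cn$ variables and at most $Cn$ clauses, such that $f$ is satisfiable, $\tilde f$ is unsatisfiable, and the literal-clause graphs with negation connections $\mathrm{LCN}(f)$ and $\mathrm{LCN}(\tilde f)$ are indistinguishable by the $n$-WL test.
   Context: A literal is a variable $x$ or its negation $\neg x$; a clause is a set of literals (their disjunction); a CNF formula is a set of clauses (their conjunction). A 3-SAT formula is a CNF formula in which every clause has at most 3 literals. For a CNF formula $f$ on variables $x_1,\dots,x_n$, the literal-clause graph with negation connections $\mathrm{LCN}(f)$ is the edge-colored graph, without vertex labels, whose vertices are the $2n$ literals $x_i,\neg x_i$ together with one vertex per clause of $f$; it has an edge of color "literal-clause" between a literal $\ell$ and a clause $c$ whenever $\ell\in c$, and an edge of a different color "literal-literal" between $x_i$ and $\neg x_i$ for each $i$. $k$-WL test ($k\ge 2$), on edge-colored graphs: the atomic type of a tuple $\bar v=(v_1,\dots,v_k)\in V(G)^k$ is such that two tuples $\bar v\in V(G)^k$, $\bar u\in V(G')^k$ have the same atomic type iff $v_i\mapsto u_i$ is an isomorphism of the induced (vertex- and edge-)colored subgraphs on $\{v_1,\dots,v_k\}$ and $\{u_1,\dots,u_k\}$ (respecting equalities among entries). Initially $\chi^0(\bar v)$ is the atomic type of $\bar v$; then $\chi^\ell(\bar v)=(\chi^{\ell-1}(\bar v),\chi^{\ell-1}_1(\bar v),\dots,\chi^{\ell-1}_k(\bar v))$ with $\chi^{\ell-1}_i(\bar v)=\{\!\{\chi^{\ell-1}(v_1,\dots,v_{i-1},u,v_{i+1},\dots,v_k):u\in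 V\}\!\}$, iterated until the induced partition of $k$-tuples stabilizes. The algorithm is run on the disjoint union of $G$ and $G'$; the test distinguishes $G$ and $G'$ if for some color the numbers of tuples of that color in $V(G)^k$ and in $V(G')^k$ differ; otherwise they are indistinguishable. *)

theory Defs
  imports Complex_Main "HOL-Library.Multiset"
begin

text \<open>A literal is a pair (i, b): (i, True) is the variable x_i, (i, False) its negation.
  A clause is a set of literals, a CNF formula is a set of clauses.
  A formula on variables x_0, ..., x_(N-1) is given by the number N of variables
  together with the clause set F.\<close>

type_synonym literal = "nat \<times> bool"
type_synonym clause = "literal set"
type_synonym cnf = "clause set"

definition cnf_on :: "nat \<Rightarrow> cnf \<Rightarrow> bool" where
  "cnf_on N F \<longleftrightarrow> (\<forall>c\<in>F. \<forall>(i, b)\<in>c. i < N)"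

definition is_3sat :: "nat \<Rightarrow> cnf \<Rightarrow> bool" where
  "is_3sat N F \<longleftrightarrow> cnf_on N F \<and> (\<forall>c\<in>F. finite c \<and> card c \<le> 3)"

definition satisfiable :: "cnf \<Rightarrow> bool" where
  "satisfiable F \<longleftrightarrow> (\<exists>\<sigma> :: nat \<Rightarrow> bool. \<forall>c\<in>F. \<exists>(i, b)\<in>c. \<sigma> i = b)"

datatype lcn_vertex = LitV literal | ClauseV clause
datatype lcn_color = LitClause | LitLit

definition lcn_V :: "nat \<Rightarrow> cnf \<Rightarrow> lcn_vertex set" where
  "lcn_V N F = LitV ` ({..<N} \<times> UNIV) \<union> ClauseV ` F"

fun lcn_E :: "lcn_vertex \<Rightarrow> lcn_vertex \<Rightarrow> lcn_color option" where
  "lcn_E (LitV l) (ClauseV c) = (if l \<in> c then Some LitClause else None)"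
| "lcn_E (ClauseV c) (LitV l) = (if l \<in> c then Some LitClause else None)"
| "lcn_E (LitV (i, b)) (LitV (j, b')) = (if i = j \<and> b \<noteq> b' then Some LitLit else None)"
| "lcn_E (ClauseV c) (ClauseV d) = None"

text \<open>An edge-coloured graph (without vertex colours) is a vertex set V together with
  an edge colouring E :: 'a \<Rightarrow> 'a \<Rightarrow> 'c option (None meaning no edge).
  k-tuples are lists of length k.\<close>

definition tuples :: "nat \<Rightarrow> 'a set \<Rightarrow> 'a list set" where
  "tuples k V = {vs. length vs = k \<and> set vs \<subseteq> V}"

definition same_atp :: "('a \<Rightarrow> 'a \<Rightarrow> 'c option) \<Rightarrow> 'a list \<Rightarrow> 'a list \<Rightarrow> bool" where
  "same_atp E vs us \<longleftrightarrow> length vs = length us \<and>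
     (\<forall>i < length vs. \<forall>j < length vs.
        (vs ! i = vs ! j \<longleftrightarrow> us ! i = us ! j) \<and> E (vs ! i) (vs ! j) = E (us ! i) (us ! j))"

text \<open>wl_rel k V E l is the equivalence relation "same colour \<chi>^l" on k-tuples;
  colours are represented by equivalence classes. The multiset of colours
  \<chi>^(l)(v_1..v_(i-1), u, v_(i+1)..v_k), u \<in> V, is rendered as an image multiset.\<close>
fun wl_rel :: "nat \<Rightarrow> 'a set \<Rightarrow> ('a \<Rightarrow> 'a \<Rightarrow> 'c option) \<Rightarrow> nat \<Rightarrow> ('a list \<times> 'a list) set" where
  "wl_rel k V E 0 = {(vs, us). vs \<in> tuples k V \<and> us \<in> tuples k V \<and> same_atp E vs us}"
| "wl_rel k V E (Suc l) = {(vs, us). (vs, us) \<in> wl_rel k V E l \<and>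
      (\<forall>i < k. image_mset (\<lambda>u. wl_rel k V E l `` {vs[i := u]}) (mset_set V)
              = image_mset (\<lambda>u. wl_rel k V E l `` {us[i := u]}) (mset_set V))}"

definition wl_stable :: "nat \<Rightarrow> 'a set \<Rightarrow> ('a \<Rightarrow> 'a \<Rightarrow> 'c option) \<Rightarrow> ('a list \<times> 'a list) set" where
  "wl_stable k V E = wl_rel k V E (LEAST l. wl_rel k V E (Suc l) = wl_rel k V E l)"

fun union_E :: "('a \<Rightarrow> 'a \<Rightarrow> 'c option) \<Rightarrow> ('b \<Rightarrow> 'b \<Rightarrow> 'c option) \<Rightarrow> 'a + 'b \<Rightarrow> 'a + 'b \<Rightarrow> 'c option" where
  "union_E E1 E2 (Inl x) (Inl y) = E1 x y"
| "union_E E1 E2 (Inr x) (Inr y) = E2 x y"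
| "union_E E1 E2 _ _ = None"

definition wl_indistinguishable ::
  "nat \<Rightarrow> 'a set \<Rightarrow> ('a \<Rightarrow> 'a \<Rightarrow> 'c option) \<Rightarrow> 'b set \<Rightarrow> ('b \<Rightarrow> 'b \<Rightarrow> 'c option) \<Rightarrow> bool" where
  "wl_indistinguishable k V1 E1 V2 E2 \<longleftrightarrow>
     (let V = V1 <+> V2; E = union_E E1 E2; R = wl_stable k V E in
      \<forall>C \<in> tuples k V // R.
        card (C \<inter> tuples k (Inl ` V1)) = card (C \<inter> tuples k (Inr ` V2)))"

end

theory Submission
  imports Defs "HOL-Library.Z2" "HOL-Library.FuncSet"
begin

text \<open>
  Take a linear system over GF(2) with at most three variables per equation and more equations than
  variables. The two formulas encode the homogeneous system and the system with an unreachable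
  right-hand side \<open>b\<close>, each equation being written as the clauses excluding its falsifying assignments.
  Negating the literals of a variable set \<open>g\<close> turns the clauses of an equation of one system into those
  of the other exactly when \<open>g\<close> solves that equation of the system with right-hand side \<open>b\<close>.
  So Duplicator survives in the bijective pebble game as long as the pebbled variables carry a partial
  assignment that can always be extended without violating an equation.

  Such assignments exist if the system expands: every nonempty set of at most \<open>2s\<close> equations has a sum
  with support more than half as large as the set. Call \<open>g\<close> good on \<open>T\<close> if it agrees with every
  consequence supported in \<open>T\<close> of at most \<open>s\<close> equations. If two derivations prescribed
  different values for a new variable, their sum would be a violated consequence supported in \<open>T\<close> of at
  most \<open>2s\<close>, hence by expansion of fewer than \<open>2|T| \<le> s\<close> equations. Linear-size expanding systems exist by a
  union bound over random systems.
\<close>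

section \<open>Weisfeiler-Leman colours and bisimulations\<close>

lemma equiv_wl_rel: "equiv (tuples k V) (wl_rel k V E l)"
proof (induction l)
  case 0
  have "refl_on (tuples k V) (wl_rel k V E 0)"
    by (auto simp: refl_on_def same_atp_def)
  moreover have "sym (wl_rel k V E 0)"
    by (rule symI) (auto simp: same_atp_def)
  moreover have "trans (wl_rel k V E 0)"
    by (rule transI) (auto simp: same_atp_def)
  moreover have "wl_rel k V E 0 \<subseteq> tuples k V \<times> tuples k V"
    by auto
  ultimately show ?case by (simp add: equiv_def)
next
  case (Suc l)
  have "refl_on (tuples k V) (wl_rel k V E (Suc l))"
    using Suc by (auto simp: refl_on_def equiv_def)
  moreover have "sym (wl_rel k V E (Suc l))"
    using Suc by (intro symI) (auto simp: equiv_def dest: symD)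
  moreover have "trans (wl_rel k V E (Suc l))"
    using Suc by (intro transI) (auto simp: equiv_def dest: transD)
  moreover have "wl_rel k V E (Suc l) \<subseteq> tuples k V \<times> tuples k V"
    using Suc by (auto simp: equiv_def)
  ultimately show ?case by (simp add: equiv_def)
qed

text \<open>The back-and-forth condition of the bijective pebble game.\<close>

lemma bisimulation_subset_wl_rel:
  assumes atp: "\<And>vs us. (vs, us) \<in> Q \<Longrightarrow> vs \<in> tuples k V \<and> us \<in> tuples k V \<and> same_atp E vs us"
    and move: "\<And>vs us i. (vs, us) \<in> Q \<Longrightarrow> i < k \<Longrightarrow>
      \<exists>\<pi>. bij_betw \<pi> V V \<and> (\<forall>w\<in>V. (vs[i := w], us[i := \<pi> w]) \<in> Q)"
  shows "Q \<subseteq> wl_rel k V E l"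
proof (induction l)
  case 0
  then show ?case using atp by auto
next
  case (Suc l)
  let ?R = "wl_rel k V E l"
  show ?case
  proof safe
    fix vs us assume Q: "(vs, us) \<in> Q"
    have "image_mset (\<lambda>u. ?R `` {vs[i := u]}) (mset_set V)
        = image_mset (\<lambda>u. ?R `` {us[i := u]}) (mset_set V)" if i: "i < k" for i
    proof -
      obtain \<pi> where pi: "bij_betw \<pi> V V" and Q': "\<forall>w\<in>V. (vs[i := w], us[i := \<pi> w]) \<in> Q"
        using move[OF Q i] by blast
      have "image_mset (\<lambda>u. ?R `` {us[i := u]}) (mset_set V)
          = image_mset (\<lambda>u. ?R `` {us[i := u]}) (image_mset \<pi> (mset_set V))"
        using pi by (simp add: image_mset_mset_set bij_betw_def)
      also have "\<dots> = image_mset (\<lambda>u. ?R `` {us[i := \<pi> u]}) (mset_set V)"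
        by (simp add: image_mset.compositionality o_def)
      also have "\<dots> = image_mset (\<lambda>u. ?R `` {vs[i := u]}) (mset_set V)"
      proof (rule image_mset_cong)
        fix u assume "u \<in># mset_set V"
        then have "u \<in> V"
          by (metis elem_mset_set empty_iff infinite_set_mset_mset_set)
        then have "(vs[i := u], us[i := \<pi> u]) \<in> ?R"
          using Q' Suc by blast
        from equiv_class_eq[OF equiv_wl_rel this]
        show "?R `` {us[i := \<pi> u]} = ?R `` {vs[i := u]}" by simp
      qed
      finally show ?thesis by simp
    qed
    then show "(vs, us) \<in> wl_rel k V E (Suc l)"
      using Q Suc by auto
  qed
qed

section \<open>Expanding linear systems over GF(2)\<close>

text \<open>Bits are kept additive so that the laws of finite sums apply; the default rules would
  turn \<open>+\<close> into xor and sums of \<open>of_bool\<close> into cardinalities.\<close>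

declare add_bit_eq_xor [simp del] sum_of_bool_eq [simp del]

lemma bit_add_self [simp]: "x + x = 0" for x :: bit
  by (cases x) simp_all

lemma bit_add_self_left [simp]: "x + (x + y) = y" for x y :: bit
  by (simp flip: add.assoc)

lemma bit_add_eq_1_iff: "x + y = 1 \<longleftrightarrow> (x = 1) \<noteq> (y = 1)" for x y :: bit
  by (cases x; cases y) simp_all

text \<open>The intersection is counted twice on the right, which vanishes in characteristic
  2.\<close>

lemma sum_bit_sym_diff:
  fixes f :: "'a \<Rightarrow> bit"
  assumes "finite X" "finite Y"
  shows "sum f (sym_diff X Y) = sum f X + sum f Y"
proof -
  have "sum f X = sum f (X - Y) + sum f (X \<inter> Y)" "sum f Y = sum f (Y - X) + sum f (X \<inter> Y)"
    using assms by (metis Int_commute sum.Int_Diff add.commute)+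
  moreover have "sum f (sym_diff X Y) = sum f (X - Y) + sum f (Y - X)"
    using assms by (intro sum.union_disjoint) auto
  ultimately show ?thesis
    by (simp add: ac_simps)
qed

text \<open>With each \<open>A j\<close> read as an indicator vector over GF(2), this is the support
  of the sum of the rows in \<open>M\<close>, the left-hand side of a derived equation.\<close>

definition odd_supp :: "(nat \<Rightarrow> nat set) \<Rightarrow> nat set \<Rightarrow> nat set" where
  "odd_supp A M = {x. (\<Sum>j\<in>M. of_bool (x \<in> A j)) \<noteq> (0 :: bit)}"

lemma odd_supp_empty [simp]: "odd_supp A {} = {}"
  by (simp add: odd_supp_def)

lemma odd_supp_singleton [simp]: "odd_supp A {j} = A j"
  by (simp add: odd_supp_def)

lemma odd_supp_sym_diff:
  assumes "finite M" "finite M'"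
  shows "odd_supp A (sym_diff M M') = sym_diff (odd_supp A M) (odd_supp A M')"
proof (rule set_eqI)
  fix x
  show "x \<in> odd_supp A (sym_diff M M') \<longleftrightarrow> x \<in> sym_diff (odd_supp A M) (odd_supp A M')"
    unfolding odd_supp_def mem_Collect_eq sum_bit_sym_diff[OF assms] Un_iff Diff_iff
      bit_not_zero_iff bit_add_eq_1_iff by blast
qed

text \<open>Expansion concerns left-hand sides only, so one system serves every right-hand side
  \<open>b\<close>. The range \<open>2 * s\<close> leaves room for adding two derivations of at most
  \<open>s\<close> equations each.\<close>

locale expanding_system =
  fixes N m s :: nat and A :: "nat \<Rightarrow> nat set" and b :: "nat \<Rightarrow> bit"
  assumes A_subset: "j < m \<Longrightarrow> A j \<subseteq> {..<N}"
    and card_A: "j < m \<Longrightarrow> card (A j) \<le> 3"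
    and expanding: "\<And>M. \<lbrakk>M \<subseteq> {..<m}; M \<noteq> {}; card M \<le> 2 * s\<rbrakk> \<Longrightarrow> card M < 2 * card (odd_supp A M)"
begin

text \<open>Only consequences of at most \<^term>\<open>s\<close> equations are tested, so \<^term>\<open>good T g\<close> is
  compatible with the whole system being unsatisfiable.\<close>

definition good :: "nat set \<Rightarrow> (nat \<Rightarrow> bool) \<Rightarrow> bool" where
  "good T g \<longleftrightarrow> (\<forall>M \<subseteq> {..<m}. card M \<le> s \<and> odd_supp A M \<subseteq> T \<longrightarrow>
     sum b M = (\<Sum>x \<in> odd_supp A M. of_bool (g x)))"

lemma good_mono: "good T g \<Longrightarrow> T' \<subseteq> T \<Longrightarrow> good T' g"
  unfolding good_def by blast

text \<open>By expansion a nonempty set of at most \<open>s\<close> equations never sums to an empty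
  left-hand side, so only the trivial consequence is tested.\<close>

lemma good_empty: "good {} g"
proof -
  have "M = {}" if "M \<subseteq> {..<m}" "card M \<le> s" "odd_supp A M \<subseteq> {}" for M
    using expanding[of M] that by force
  then show ?thesis
    unfolding good_def by (metis card.empty odd_supp_empty sum.empty)
qed

lemma good_equation:
  assumes "good T g" "j < m" "A j \<subseteq> T" "1 \<le> s"
  shows "b j = (\<Sum>x \<in> A j. of_bool (g x))"
proof -
  show ?thesis
    using assms(1)[unfolded good_def, rule_format, of "{j}"] assms by simp
qed

lemma good_insert:
  assumes g: "good T g" and fin: "finite T" and T: "2 * card T \<le> s"
  shows "\<exists>g'. (\<forall>y\<in>T. g' y = g y) \<and> good (insert x T) g'"
proof (cases "x \<notin> T \<and> (\<exists>M\<subseteq>{..<m}. card M \<le> s \<and> odd_supp A M \<subseteq> insert x T \<and> x \<in> odd_supp A M)")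
  case False
  then have "good (insert x T) g"
    using g unfolding good_def by blast
  then show ?thesis by blast
next
  case True
  then obtain M0 where x: "x \<notin> T" and M0: "M0 \<subseteq> {..<m}" "card M0 \<le> s"
    "odd_supp A M0 \<subseteq> insert x T" "x \<in> odd_supp A M0" by blast
  have finM: "finite M" if "M \<subseteq> {..<m}" for M
    using that finite_subset by blast
  have finS: "finite M" if "M \<subseteq> insert x T" for M
    using that fin finite_subset by blast
  \<comment> \<open>The value of \<open>x\<close> that the derivation \<open>M0\<close> forces,
    given \<open>g\<close> on its other variables.\<close>
  define v where "v = (sum b M0 + (\<Sum>y \<in> odd_supp A M0 - {x}. of_bool (g y)) = (1 :: bit))"
  define g' where "g' = g(x := v)"
  have agree: "(\<Sum>y\<in>S. of_bool (g' y)) = (\<Sum>y\<in>S. of_bool (g y) :: bit)" if "x \<notin> S" for S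
    using that by (intro sum.cong) (auto simp: g'_def)
  have "(\<Sum>y\<in>odd_supp A M0. of_bool (g' y) :: bit)
      = of_bool (g' x) + (\<Sum>y\<in>odd_supp A M0 - {x}. of_bool (g' y))"
    using M0 finS by (intro sum.remove) auto
  also have "\<dots> = of_bool v + (\<Sum>y\<in>odd_supp A M0 - {x}. of_bool (g y))"
    by (simp add: agree) (simp add: g'_def)
  also have "\<dots> = sum b M0"
    unfolding v_def
    by (cases "sum b M0"; cases "\<Sum>y\<in>odd_supp A M0 - {x}. of_bool (g y) :: bit") simp_all
  finally have eq0: "sum b M0 = (\<Sum>y\<in>odd_supp A M0. of_bool (g' y))" by simp
  have "sum b M = (\<Sum>y\<in>odd_supp A M. of_bool (g' y))"
    if M: "M \<subseteq> {..<m}" "card M \<le> s" "odd_supp A M \<subseteq> insert x T" for M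
  proof (cases "x \<in> odd_supp A M")
    case False
    then show ?thesis
      using g M agree[OF False] unfolding good_def by (metis subset_insert)
  next
    case True
    let ?D = "sym_diff M M0"
    have supp: "odd_supp A ?D = sym_diff (odd_supp A M) (odd_supp A M0)"
      using M M0 by (intro odd_supp_sym_diff finM)
    have D: "?D \<subseteq> {..<m}" "odd_supp A ?D \<subseteq> T"
      using M M0 True unfolding supp by auto
    \<comment> \<open>Adding the two derivations eliminates \<open>x\<close>, so the support lies in
      \<open>T\<close>; expansion then pushes the size from \<open>2 * s\<close> back below
      \<open>2 * card T\<close>, and \<open>g\<close> is known to satisfy the sum.\<close>
    have "card ?D \<le> s"
    proof (cases "?D = {}")
      case False
      have "card ?D \<le> card M + card M0"
        using M M0 finM by (intro order_trans[OF card_Un_le] add_mono card_mono) auto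
      then have "card ?D < 2 * card (odd_supp A ?D)"
        using D False M M0 by (intro expanding) auto
      also have "card (odd_supp A ?D) \<le> card T"
        using D fin by (intro card_mono)
      finally show ?thesis using T by simp
    qed (simp only: card.empty)
    then have "sum b ?D = (\<Sum>y \<in> odd_supp A ?D. of_bool (g y))"
      using g D unfolding good_def by blast
    also have "\<dots> = (\<Sum>y \<in> odd_supp A ?D. of_bool (g' y))"
      using D x by (intro agree[symmetric]) auto
    finally have "sum b M + sum b M0 =
        (\<Sum>y\<in>odd_supp A M. of_bool (g' y)) + (\<Sum>y\<in>odd_supp A M0. of_bool (g' y))"
      unfolding supp using M M0 by (simp add: sum_bit_sym_diff finM finS)
    then show ?thesis using eq0 by simp
  qed
  then have "good (insert x T) g'"
    unfolding good_def by blast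
  moreover have "\<forall>y\<in>T. g' y = g y"
    using x by (auto simp: g'_def)
  ultimately show ?thesis by blast
qed

lemma good_union:
  assumes "finite I" "good T g" "finite T" "2 * (card T + card I) \<le> s"
  shows "\<exists>g'. (\<forall>y\<in>T. g' y = g y) \<and> good (T \<union> I) g'"
  using assms(1,4)
proof (induction I)
  case empty
  then show ?case using assms by auto
next
  case (insert x I)
  then obtain g' where g': "\<forall>y\<in>T. g' y = g y" "good (T \<union> I) g'"
    by auto
  have "2 * card (T \<union> I) \<le> s"
    using insert card_Un_le[of T I] by simp
  from good_insert[OF g'(2) _ this, of x] obtain g'' where
    "\<forall>y\<in>T \<union> I. g'' y = g' y" "good (insert x (T \<union> I)) g''"
    using assms insert by auto
  then show ?case using g' by auto
qed

end

section \<open>Existence of expanding systems\<close>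

text \<open>The \<open>n\<close>-th term of the exponential series at \<open>n\<close> is at most
  its sum, and e is at most 3.\<close>

lemma power_self_le: "n ^ n \<le> 3 ^ n * fact n" for n :: nat
proof -
  have "(\<Sum>k\<in>{n}. inverse (fact k) * real n ^ k) \<le> (\<Sum>k. inverse (fact k) * real n ^ k)"
    by (intro sum_le_suminf summable_exp) auto
  also have "\<dots> = exp (real n)"
    by (simp add: exp_def)
  also have "\<dots> = exp 1 ^ n"
    by (simp add: exp_of_nat_mult[symmetric])
  also have "\<dots> \<le> 3 ^ n"
    by (intro power_mono exp_le) auto
  finally have "real (n ^ n) \<le> real (3 ^ n * fact n)"
    by (simp add: field_simps)
  then show ?thesis by linarith
qed

text \<open>The usual bound of the binomial coefficient by (en/k)^k, with 3 for e and the
  denominator cleared.\<close>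

lemma choose_mult_power_le: "(n choose k) * k ^ k \<le> (3 * n) ^ k"
proof -
  have "(n choose k) * k ^ k \<le> (n choose k) * (3 ^ k * fact k)"
    by (intro mult_le_mono2 power_self_le)
  also have "\<dots> = 3 ^ k * ((n choose k) * fact k)" by simp
  also have "\<dots> \<le> 3 ^ k * n ^ k"
    by (intro mult_le_mono2 binomial_fact_pow)
  finally show ?thesis by (simp add: power_mult_distrib)
qed

text \<open>A set of \<^term>\<open>t\<close> equations with a small sum uses at most \<^term>\<open>7 * t div 4\<close> distinct variables
  in its \<^term>\<open>3 * t\<close> slots.\<close>

lemma union_bound_term:
  fixes m N t w :: nat
  assumes m: "m \<le> 2 * N" and t: "t \<ge> 1" and w: "w = 7 * t div 4" and N: "432 ^ 4 * w \<le> N"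
  shows "4 ^ t * ((m choose t) * (N choose w) * w ^ (3 * t)) \<le> N ^ (3 * t)"
proof -
  have w2: "w \<le> 2 * t" and e: "t \<le> 4 * (2 * t - w)" and e3: "3 * t = w + (t + (2 * t - w))"
    using w by auto
  \<comment> \<open>The slack \<open>2 * t - w\<close> is at least t/4, so the fourth power of 432
    in the bound on \<open>N\<close> pays for a factor \<open>432 ^ t\<close>.\<close>
  have small: "432 ^ t * w ^ (2 * t - w) \<le> N ^ (2 * t - w)"
  proof -
    have "432 ^ t * w ^ (2 * t - w) \<le> 432 ^ (4 * (2 * t - w)) * w ^ (2 * t - w)"
      using e by (intro mult_le_mono1 power_increasing) auto
    also have "\<dots> = (432 ^ 4 * w) ^ (2 * t - w)"
      by (simp only: power_mult power_mult_distrib)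
    also have "\<dots> \<le> N ^ (2 * t - w)"
      using N by (intro power_mono) auto
    finally show ?thesis .
  qed
  \<comment> \<open>The factor \<open>t ^ t\<close> clears the denominator of the bound on
    \<open>m choose t\<close> and is cancelled at the end. The constants 4, 6 and 2 together with
    \<open>3 ^ w\<close>, at most \<open>9 ^ t\<close>, collect to \<open>432 ^ t\<close>.\<close>
  have "t ^ t * (4 ^ t * ((m choose t) * (N choose w) * w ^ (3 * t)))
      = 4 ^ t * ((m choose t) * t ^ t) * ((N choose w) * w ^ w) * w ^ t * w ^ (2 * t - w)"
    unfolding e3 power_add by (simp only: ac_simps)
  also have "\<dots> \<le> 4 ^ t * (6 * N) ^ t * (3 * N) ^ w * (2 * t) ^ t * w ^ (2 * t - w)"
  proof (intro mult_le_mono order_refl)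
    have "(m choose t) * t ^ t \<le> (3 * m) ^ t" by (rule choose_mult_power_le)
    also have "\<dots> \<le> (6 * N) ^ t" using m by (intro power_mono) auto
    finally show "(m choose t) * t ^ t \<le> (6 * N) ^ t" .
    show "(N choose w) * w ^ w \<le> (3 * N) ^ w" by (rule choose_mult_power_le)
    show "w ^ t \<le> (2 * t) ^ t" using w2 by (intro power_mono) auto
  qed
  also have "\<dots> = (48 ^ t * 3 ^ w) * (t ^ t * N ^ t * N ^ w * w ^ (2 * t - w))"
  proof -
    have "(48 :: nat) ^ t = 4 ^ t * 6 ^ t * 2 ^ t"
      by (simp add: power_mult_distrib[symmetric])
    then show ?thesis by (simp only: power_mult_distrib ac_simps)
  qed
  also have "\<dots> \<le> 432 ^ t * (t ^ t * N ^ t * N ^ w * w ^ (2 * t - w))"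
  proof (intro mult_le_mono1)
    have "(48 :: nat) ^ t * 3 ^ w \<le> 48 ^ t * 3 ^ (2 * t)"
      using w2 by (intro mult_le_mono2 power_increasing) auto
    also have "\<dots> = 432 ^ t"
      by (simp add: power_mult power_mult_distrib[symmetric])
    finally show "(48 :: nat) ^ t * 3 ^ w \<le> 432 ^ t" .
  qed
  also have "\<dots> = t ^ t * N ^ t * N ^ w * (432 ^ t * w ^ (2 * t - w))"
    by (simp only: ac_simps)
  also have "\<dots> \<le> t ^ t * N ^ t * N ^ w * N ^ (2 * t - w)"
    by (intro mult_le_mono2 small)
  also have "\<dots> = t ^ t * N ^ (3 * t)"
    unfolding e3 power_add by (simp only: ac_simps)
  finally show ?thesis using t by simp
qed

text \<open>For a map from equation slots to variables this is the support of the sum of the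
  equations: a variable filling an even number of slots cancels.\<close>

definition odd_fibres :: "('a \<Rightarrow> 'b) \<Rightarrow> 'a set \<Rightarrow> 'b set" where
  "odd_fibres f P = {x. odd (card {p \<in> P. f p = x})}"

text \<open>A value hit exactly once has an odd fibre, and every other value taken is hit at least
  twice.\<close>

lemma card_image_le_odd_fibres:
  assumes "finite P"
  shows "2 * card (f ` P) \<le> card P + card (odd_fibres f P)"
proof -
  let ?c = "\<lambda>x. card {p \<in> P. f p = x}"
  have sub: "odd_fibres f P \<subseteq> f ` P"
  proof
    fix x assume "x \<in> odd_fibres f P"
    then have "{p \<in> P. f p = x} \<noteq> {}"
      unfolding odd_fibres_def by (metis (mono_tags) card.empty even_zero mem_Collect_eq)
    then show "x \<in> f ` P" by auto
  qed
  have "2 * card (f ` P) = (\<Sum>x\<in>f ` P. 2)" by simp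
  also have "\<dots> \<le> (\<Sum>x\<in>f ` P. ?c x + of_bool (x \<in> odd_fibres f P))"
  proof (rule sum_mono)
    fix x assume "x \<in> f ` P"
    then have "?c x > 0"
      using assms by (auto simp: card_gt_0_iff)
    moreover have "?c x = 1 \<Longrightarrow> x \<in> odd_fibres f P"
      by (simp add: odd_fibres_def)
    ultimately show "2 \<le> ?c x + of_bool (x \<in> odd_fibres f P)"
      by (cases "?c x = 1") auto
  qed
  also have "\<dots> = (\<Sum>x\<in>f ` P. ?c x) + card (odd_fibres f P)"
  proof -
    have "f ` P \<inter> odd_fibres f P = odd_fibres f P" using sub by blast
    then show ?thesis
      using assms by (simp add: sum.distrib sum_of_bool_eq)
  qed
  also have "(\<Sum>x\<in>f ` P. ?c x) = card P"
    using sum.group[OF assms finite_imageI[OF assms] subset_refl, of "\<lambda>_. 1 :: nat" f]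
    by simp
  finally show ?thesis .
qed

text \<open>The image of \<open>P\<close> fits into some set \<open>W\<close> of exactly
  \<open>w\<close> values; for fixed \<open>W\<close> the points of \<open>P\<close> have
  \<open>w\<close> choices each and the others \<open>N\<close>.\<close>

lemma card_functions_clustered_le:
  fixes P Q :: "'a set" and N w :: nat
  assumes fin: "finite Q" and P: "P \<subseteq> Q" and w: "w \<le> N"
  shows "card {f \<in> Q \<rightarrow>\<^sub>E {..<N}. card (f ` P) \<le> w} \<le> (N choose w) * (w ^ card P * N ^ (card Q - card P))"
proof -
  let ?K = "{W. W \<subseteq> {..<N} \<and> card W = w}"
  let ?S = "\<lambda>W. PiE Q (\<lambda>p. if p \<in> P then W else {..<N})"
  have "{f \<in> Q \<rightarrow>\<^sub>E {..<N}. card (f ` P) \<le> w} \<subseteq> (\<Union>W\<in>?K. ?S W)"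
  proof safe
    fix f assume f: "f \<in> Q \<rightarrow>\<^sub>E {..<N}" "card (f ` P) \<le> w"
    have "f ` P \<subseteq> {..<N}" using f P by auto
    then obtain W where "f ` P \<subseteq> W" "W \<subseteq> {..<N}" "card W = w"
      using exists_subset_between[of "f ` P" w "{..<N}"] f w by auto
    then show "f \<in> (\<Union>W\<in>?K. ?S W)"
      using f by (auto simp: PiE_iff)
  qed
  then have "card {f \<in> Q \<rightarrow>\<^sub>E {..<N}. card (f ` P) \<le> w} \<le> card (\<Union>W\<in>?K. ?S W)"
    using fin by (intro card_mono finite_UN_I finite_PiE) (auto intro: finite_subset)
  also have "\<dots> \<le> (\<Sum>W\<in>?K. card (?S W))"
    by (intro card_UN_le) auto
  also have "\<dots> = (\<Sum>W\<in>?K. w ^ card P * N ^ (card Q - card P))"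
  proof (intro sum.cong refl)
    fix W assume W: "W \<in> ?K"
    have "card (?S W) = (\<Prod>p\<in>Q. if p \<in> P then w else N)"
      using W fin by (auto simp: card_PiE intro!: prod.cong)
    also have "\<dots> = w ^ card (Q \<inter> P) * N ^ card (Q \<inter> - P)"
      using fin by (simp add: prod.If_cases)
    also have "Q \<inter> P = P" using P by blast
    also have "Q \<inter> - P = Q - P" by blast
    also have "card (Q - P) = card Q - card P"
      using P fin by (intro card_Diff_subset) (auto intro: finite_subset)
    finally show "card (?S W) = w ^ card P * N ^ (card Q - card P)" .
  qed
  also have "\<dots> = (N choose w) * (w ^ card P * N ^ (card Q - card P))"
    using n_subsets[of "{..<N}" w] by simp
  finally show ?thesis .
qed

lemma sum_quarter_powers_less: "(\<Sum>t = 1..n. (1 / 4) ^ t) < (1 :: real)"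
proof -
  have "(\<Sum>t = 1..n. (1 / 4) ^ t) \<le> (1 :: real) - (1 / 4) ^ n"
  proof (induction n)
    case (Suc n)
    have "(\<Sum>t = 1..Suc n. (1 / 4 :: real) ^ t) = (\<Sum>t = 1..n. (1 / 4) ^ t) + (1 / 4) ^ n / 4"
      by simp
    moreover have "(1 / 4 :: real) ^ Suc n = (1 / 4) ^ n / 4" "(1 / 4 :: real) ^ n > 0"
      by auto
    ultimately show ?case using Suc by linarith
  qed simp
  also have "\<dots> < 1" by simp
  finally show ?thesis .
qed

lemma expanding_function_exists:
  fixes m N s :: nat
  assumes s: "s \<ge> 1" and m: "m \<le> 2 * N" and N: "432 ^ 4 * (4 * s) \<le> N"
  shows "\<exists>f \<in> {..<m} \<times> {..<3} \<rightarrow>\<^sub>E {..<N}. \<forall>M \<subseteq> {..<m}. M \<noteq> {} \<longrightarrow> card M \<le> 2 * s \<longrightarrow>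
    card M < 2 * card (odd_fibres f (M \<times> {..<3 :: nat}))"
proof (rule ccontr)
  assume none: "\<not> ?thesis"
  let ?Q = "{..<m} \<times> {..<3 :: nat}"
  let ?U = "?Q \<rightarrow>\<^sub>E {..<N}"
  let ?w = "\<lambda>t. 7 * t div 4"
  let ?bad = "\<lambda>M. {f \<in> ?U. card (f ` (M \<times> {..<3})) \<le> ?w (card M)}"
  let ?K = "\<lambda>t. {M. M \<subseteq> {..<m} \<and> card M = t}"
  have "?U \<subseteq> (\<Union>t\<in>{1..2 * s}. \<Union>M\<in>?K t. ?bad M)"
  proof
    fix f assume f: "f \<in> ?U"
    then obtain M where M: "M \<subseteq> {..<m}" "M \<noteq> {}" "card M \<le> 2 * s"
      "2 * card (odd_fibres f (M \<times> {..<3 :: nat})) \<le> card M"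
      using none by (metis linorder_not_less)
    have "finite M" using M finite_subset by blast
    then have "2 * card (f ` (M \<times> {..<3})) \<le> card (M \<times> {..<3 :: nat}) + card (odd_fibres f (M \<times> {..<3 :: nat}))"
      by (intro card_image_le_odd_fibres) auto
    \<comment> \<open>With \<open>t = card M\<close> there are \<open>3 * t\<close> slots and at
      most t/2 odd fibres, so twice the image has at most 7t/2 elements.\<close>
    then have "card (f ` (M \<times> {..<3})) \<le> ?w (card M)"
      using M by (simp add: card_cartesian_product)
    moreover have "card M \<ge> 1"
      using M \<open>finite M\<close> by (simp add: Suc_le_eq card_gt_0_iff)
    ultimately show "f \<in> (\<Union>t\<in>{1..2 * s}. \<Union>M\<in>?K t. ?bad M)"
      using f M by auto
  qed
  moreover have "finite ?U" by (intro finite_PiE) auto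
  then have "finite (\<Union>t\<in>{1..2 * s}. \<Union>M\<in>?K t. ?bad M)"
    by (rule rev_finite_subset) blast
  ultimately have "card ?U \<le> card (\<Union>t\<in>{1..2 * s}. \<Union>M\<in>?K t. ?bad M)"
    by (intro card_mono)
  also have "\<dots> \<le> (\<Sum>t = 1..2 * s. card (\<Union>M\<in>?K t. ?bad M))"
    by (rule card_UN_le) simp
  finally have le: "card ?U \<le> (\<Sum>t = 1..2 * s. card (\<Union>M\<in>?K t. ?bad M))" .
  have U: "card ?U = N ^ (3 * m)"
    by (simp add: card_PiE mult.commute)
  have "N > 0" using s N by simp
  \<comment> \<open>At most a fraction of 4^(-t) of all functions fails on some set of
    \<open>t\<close> equations. The case \<open>t > m\<close> is split off because
    \<open>3 * m - 3 * t\<close> is truncated subtraction.\<close>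
  have level: "real (card (\<Union>M\<in>?K t. ?bad M)) \<le> real N ^ (3 * m) * (1 / 4) ^ t"
    if t: "t \<in> {1..2 * s}" for t
  proof (cases "t \<le> m")
    case True
    have wN: "432 ^ 4 * ?w t \<le> N"
    proof (rule order_trans[OF mult_le_mono2 N])
      show "?w t \<le> 4 * s" using t by auto
    qed
    have "card (\<Union>M\<in>?K t. ?bad M) \<le> (\<Sum>M\<in>?K t. card (?bad M))"
      by (intro card_UN_le) auto
    also have "\<dots> \<le> (\<Sum>M\<in>?K t. (N choose ?w t) * (?w t ^ (3 * t) * N ^ (3 * m - 3 * t)))"
    proof (rule sum_mono)
      fix M assume M: "M \<in> ?K t"
      then have "M \<times> {..<3} \<subseteq> ?Q" and "?w (card M) \<le> N"
        using wN by auto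
      then have "card (?bad M) \<le> (N choose ?w (card M)) *
          (?w (card M) ^ card (M \<times> {..<3 :: nat}) * N ^ (card ?Q - card (M \<times> {..<3 :: nat})))"
        by (intro card_functions_clustered_le) auto
      then show "card (?bad M) \<le> (N choose ?w t) * (?w t ^ (3 * t) * N ^ (3 * m - 3 * t))"
        using M by (simp add: card_cartesian_product mult.commute)
    qed
    also have "\<dots> = (m choose t) * (N choose ?w t) * ?w t ^ (3 * t) * N ^ (3 * m - 3 * t)"
      using n_subsets[of "{..<m}" t] by simp
    finally have "4 ^ t * card (\<Union>M\<in>?K t. ?bad M)
        \<le> 4 ^ t * ((m choose t) * (N choose ?w t) * ?w t ^ (3 * t)) * N ^ (3 * m - 3 * t)"
      by (simp add: mult.assoc)
    also have "\<dots> \<le> N ^ (3 * t) * N ^ (3 * m - 3 * t)"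
      using t wN m by (intro mult_le_mono1 union_bound_term) auto
    also have "\<dots> = N ^ (3 * m)"
      using True by (simp add: power_add[symmetric])
    finally have "real (4 ^ t * card (\<Union>M\<in>?K t. ?bad M)) \<le> real (N ^ (3 * m))"
      by (rule of_nat_mono)
    then show ?thesis by (simp add: field_simps)
  next
    case False
    then have "?K t = {}"
      by (metis (mono_tags, lifting) Collect_empty_eq card_lessThan card_mono finite_lessThan)
    then show ?thesis by (simp only: UN_empty card.empty) simp
  qed
  have "real N ^ (3 * m) \<le> (\<Sum>t = 1..2 * s. real (card (\<Union>M\<in>?K t. ?bad M)))"
    using of_nat_mono[OF le, where 'a = real] unfolding U of_nat_power of_nat_sum .
  also have "\<dots> \<le> (\<Sum>t = 1..2 * s. real N ^ (3 * m) * (1 / 4) ^ t)"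
    by (rule sum_mono) (rule level)
  also have "\<dots> = real N ^ (3 * m) * (\<Sum>t = 1..2 * s. (1 / 4) ^ t)"
    by (rule sum_distrib_left[symmetric])
  also have "\<dots> < real N ^ (3 * m) * 1"
    using \<open>N > 0\<close> by (intro mult_strict_left_mono sum_quarter_powers_less) auto
  finally show False by simp
qed

text \<open>Slots of different equations are disjoint, so fibre sizes add up over \<open>M\<close>,
  and reduction modulo 2 is additive.\<close>

lemma odd_supp_eq_odd_fibres:
  assumes "finite M" "\<And>j. j \<in> M \<Longrightarrow> A j = odd_fibres f ({j} \<times> {..<3 :: nat})"
  shows "odd_supp A M = odd_fibres f (M \<times> {..<3 :: nat})"
proof -
  have of_nat_bit: "(of_bool (odd n) :: bit) = of_nat n" for n
    by (induction n) auto
  have "(\<Sum>j\<in>M. of_bool (x \<in> A j)) = (of_bool (x \<in> odd_fibres f (M \<times> {..<3})) :: bit)" for x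
  proof -
    have "(\<Sum>j\<in>M. of_bool (x \<in> A j)) = (\<Sum>j\<in>M. of_nat (card {p \<in> {j} \<times> {..<3}. f p = x}) :: bit)"
      using assms(2) by (simp add: odd_fibres_def of_nat_bit)
    also have "\<dots> = of_nat (\<Sum>j\<in>M. card {p \<in> {j} \<times> {..<3}. f p = x})"
      by simp
    also have "(\<Sum>j\<in>M. card {p \<in> {j} \<times> {..<3}. f p = x}) = card (\<Union>j\<in>M. {p \<in> {j} \<times> {..<3}. f p = x})"
      using assms(1) by (intro card_UN_disjoint[symmetric]) auto
    also have "(\<Union>j\<in>M. {p \<in> {j} \<times> {..<3}. f p = x}) = {p \<in> M \<times> {..<3}. f p = x}"
      by auto
    finally show ?thesis by (simp add: odd_fibres_def of_nat_bit)
  qed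
  then show ?thesis by (auto simp: odd_supp_def)
qed

lemma expanding_system_exists:
  fixes s m N :: nat
  assumes "s \<ge> 1" "m \<le> 2 * N" "432 ^ 4 * (4 * s) \<le> N"
  shows "\<exists>A. expanding_system N m s A"
proof -
  obtain f where f: "f \<in> {..<m} \<times> {..<3} \<rightarrow>\<^sub>E {..<N}"
    and exp: "\<And>M. M \<subseteq> {..<m} \<Longrightarrow> M \<noteq> {} \<Longrightarrow> card M \<le> 2 * s \<Longrightarrow>
      card M < 2 * card (odd_fibres f (M \<times> {..<3 :: nat}))"
    using expanding_function_exists[OF assms] by blast
  define A where "A j = odd_fibres f ({j} \<times> {..<3 :: nat})" for j
  have sub: "A j \<subseteq> f ` ({j} \<times> {..<3})" for j
  proof
    fix x assume "x \<in> A j"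
    then have "{p \<in> {j} \<times> {..<3}. f p = x} \<noteq> {}"
      unfolding A_def odd_fibres_def by (metis (mono_tags) card.empty even_zero mem_Collect_eq)
    then show "x \<in> f ` ({j} \<times> {..<3})" by auto
  qed
  have "expanding_system N m s A"
  proof
    fix j assume "j < m"
    then show "A j \<subseteq> {..<N}" using sub[of j] f by (auto simp: PiE_iff)
  next
    fix j
    have "card (A j) \<le> card (f ` ({j} \<times> {..<3 :: nat}))"
      by (intro card_mono sub) auto
    also have "\<dots> \<le> card ({j} \<times> {..<3 :: nat})"
      by (intro card_image_le) auto
    finally show "card (A j) \<le> 3" by simp
  next
    fix M assume "M \<subseteq> {..<m}" "M \<noteq> {}" "card M \<le> 2 * s"
    then show "card M < 2 * card (odd_supp A M)"
      using exp[of M] odd_supp_eq_odd_fibres[of M A f] finite_subset[of M "{..<m}"]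
      by (auto simp: A_def)
  qed
  then show ?thesis by blast
qed

section \<open>Encoding linear systems as formulas\<close>

text \<open>The unique assignment to \<^term>\<open>A j\<close> that falsifies a clause \<^term>\<open>c\<close> with variable set \<^term>\<open>A j\<close>
  makes the variables of the negative literals true.\<close>

definition parity_clauses :: "nat \<Rightarrow> (nat \<Rightarrow> nat set) \<Rightarrow> (nat \<Rightarrow> bit) \<Rightarrow> cnf" where
  "parity_clauses m A \<beta> = {c. \<exists>j<m. inj_on fst c \<and> fst ` c = A j \<and>
     (\<Sum>l\<in>c. of_bool (\<not> snd l)) \<noteq> \<beta> j}"

text \<open>An assignment falsifies exactly one clause with variable set \<open>A j\<close>, and
  equation \<open>j\<close> contributes that clause iff the assignment violates it.\<close>

lemma satisfiable_parity_clauses: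
  assumes fin: "\<And>j. j < m \<Longrightarrow> finite (A j)"
  shows "satisfiable (parity_clauses m A \<beta>) \<longleftrightarrow>
    (\<exists>\<sigma>. \<forall>j<m. (\<Sum>x\<in>A j. of_bool (\<sigma> x)) = \<beta> j)"
proof
  assume "satisfiable (parity_clauses m A \<beta>)"
  then obtain \<sigma> where sat: "\<And>c. c \<in> parity_clauses m A \<beta> \<Longrightarrow> \<exists>(i, b)\<in>c. \<sigma> i = b"
    unfolding satisfiable_def by blast
  have "(\<Sum>x\<in>A j. of_bool (\<sigma> x)) = \<beta> j" if j: "j < m" for j
  proof (rule ccontr)
    assume ne: "(\<Sum>x\<in>A j. of_bool (\<sigma> x)) \<noteq> \<beta> j"
    let ?c = "(\<lambda>x. (x, \<not> \<sigma> x)) ` A j"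
    have "(\<Sum>l\<in>?c. of_bool (\<not> snd l)) = (\<Sum>x\<in>A j. of_bool (\<sigma> x) :: bit)"
      by (subst sum.reindex) (auto simp: inj_on_def)
    moreover have "inj_on fst ?c" "fst ` ?c = A j"
      by (auto simp: inj_on_def image_image)
    ultimately have "?c \<in> parity_clauses m A \<beta>"
      using j ne unfolding parity_clauses_def by auto
    then show False using sat by fastforce
  qed
  then show "\<exists>\<sigma>. \<forall>j<m. (\<Sum>x\<in>A j. of_bool (\<sigma> x)) = \<beta> j" by blast
next
  assume "\<exists>\<sigma>. \<forall>j<m. (\<Sum>x\<in>A j. of_bool (\<sigma> x)) = \<beta> j"
  then obtain \<sigma> where \<sigma>: "\<And>j. j < m \<Longrightarrow> (\<Sum>x\<in>A j. of_bool (\<sigma> x)) = \<beta> j" by blast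
  have "\<exists>(i, b)\<in>c. \<sigma> i = b" if c: "c \<in> parity_clauses m A \<beta>" for c
  proof (rule ccontr)
    assume "\<not> ?thesis"
    then have falsified: "\<not> snd l \<longleftrightarrow> \<sigma> (fst l)" if "l \<in> c" for l
      using that by (cases l) force
    obtain j where j: "j < m" "inj_on fst c" "fst ` c = A j" "(\<Sum>l\<in>c. of_bool (\<not> snd l)) \<noteq> \<beta> j"
      using c unfolding parity_clauses_def by blast
    have "(\<Sum>l\<in>c. of_bool (\<not> snd l)) = (\<Sum>l\<in>c. of_bool (\<sigma> (fst l)) :: bit)"
      using falsified by (intro sum.cong refl) simp
    also have "\<dots> = (\<Sum>x\<in>fst ` c. of_bool (\<sigma> x))"
      using sum.reindex[OF j(2), of "\<lambda>x. of_bool (\<sigma> x) :: bit"] by simp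
    also have "\<dots> = \<beta> j"
      unfolding j(3) by (rule \<sigma>[OF j(1)])
    finally show False using j(4) by simp
  qed
  then show "satisfiable (parity_clauses m A \<beta>)"
    unfolding satisfiable_def by blast
qed

text \<open>The assignments on \<^term>\<open>{..<N}\<close> reach at most \<^term>\<open>2 ^ N\<close> of the \<^term>\<open>2 ^ m\<close> right-hand sides.\<close>

lemma unsatisfiable_rhs_exists:
  fixes A :: "nat \<Rightarrow> nat set"
  assumes A: "\<And>j. j < m \<Longrightarrow> A j \<subseteq> {..<N}" and "N < m"
  shows "\<exists>\<beta>. \<not> (\<exists>\<sigma>. \<forall>j<m. (\<Sum>x\<in>A j. of_bool (\<sigma> x)) = (\<beta> j :: bit))"
proof (rule ccontr)
  assume all: "\<not> ?thesis"
  let ?r = "\<lambda>S. \<lambda>j\<in>{..<m}. (\<Sum>x\<in>A j. of_bool (x \<in> S)) :: bit"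
  have "{..<m} \<rightarrow>\<^sub>E {0, 1} \<subseteq> ?r ` Pow {..<N}"
  proof
    fix \<beta> :: "nat \<Rightarrow> bit" assume \<beta>: "\<beta> \<in> {..<m} \<rightarrow>\<^sub>E {0, 1}"
    obtain \<sigma> where \<sigma>: "\<And>j. j < m \<Longrightarrow> (\<Sum>x\<in>A j. of_bool (\<sigma> x)) = \<beta> j"
      using all by blast
    let ?S = "{x. x < N \<and> \<sigma> x}"
    have "?r ?S j = \<beta> j" for j
    proof (cases "j < m")
      case True
      have "(\<Sum>x\<in>A j. of_bool (x \<in> ?S)) = (\<Sum>x\<in>A j. of_bool (\<sigma> x) :: bit)"
        using A[OF True] by (intro sum.cong) auto
      then show ?thesis using \<sigma>[OF True] True by simp
    next
      case False
      then show ?thesis using \<beta> by (auto simp: PiE_def extensional_def)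
    qed
    then have "\<beta> = ?r ?S" by (metis ext)
    then show "\<beta> \<in> ?r ` Pow {..<N}" by blast
  qed
  then have "card ({..<m} \<rightarrow>\<^sub>E {0, 1 :: bit}) \<le> card (?r ` Pow {..<N})"
    by (intro card_mono) auto
  also have "\<dots> \<le> card (Pow {..<N})"
    by (intro card_image_le) auto
  finally have "(2 :: nat) ^ m \<le> 2 ^ N"
    by (simp add: card_PiE card_Pow numeral_2_eq_2)
  then show False using \<open>N < m\<close> by simp
qed

lemma is_3sat_parity_clauses:
  assumes "\<And>j. j < m \<Longrightarrow> A j \<subseteq> {..<N}" "\<And>j. j < m \<Longrightarrow> card (A j) \<le> 3"
  shows "is_3sat N (parity_clauses m A \<beta>)"
  unfolding is_3sat_def cnf_on_def
proof (intro conjI ballI)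
  fix c assume "c \<in> parity_clauses m A \<beta>"
  then obtain j where j: "j < m" "inj_on fst c" "fst ` c = A j"
    unfolding parity_clauses_def by blast
  have "finite (A j)" using assms(1)[OF j(1)] finite_subset by blast
  then show "finite c" using j finite_imageD by metis
  show "card c \<le> 3" using card_image[OF j(2)] j assms(2) by metis
  show "case l of (i, b) \<Rightarrow> i < N" if "l \<in> c" for l
    using that j assms(1)[of j] by (cases l) force
qed

text \<open>A clause with one literal per variable is determined by its variable set and its
  positive variables; this yields at most 8 clauses per equation.\<close>

lemma parity_clauses_subset_Union:
  "parity_clauses m A \<beta> \<subseteq> (\<Union>j<m. (\<lambda>S. (\<lambda>x. (x, x \<in> S)) ` A j) ` Pow (A j))"
proof
  fix c assume "c \<in> parity_clauses m A \<beta>"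
  then obtain j where j: "j < m" "inj_on fst c" "fst ` c = A j"
    unfolding parity_clauses_def by blast
  let ?S = "{x. (x, True) \<in> c}"
  have "c = (\<lambda>x. (x, x \<in> ?S)) ` fst ` c"
    using j(2) unfolding image_image inj_on_def by (auto simp: image_iff; metis (full_types) fst_conv snd_conv)
  moreover have "?S \<subseteq> A j" using j(3) by force
  ultimately have "c \<in> (\<lambda>S. (\<lambda>x. (x, x \<in> S)) ` A j) ` Pow (A j)"
    unfolding j(3) by blast
  then show "c \<in> (\<Union>j<m. (\<lambda>S. (\<lambda>x. (x, x \<in> S)) ` A j) ` Pow (A j))"
    using j(1) by blast
qed

lemma card_parity_clauses:
  assumes fin: "\<And>j. j < m \<Longrightarrow> finite (A j)" and three: "\<And>j. j < m \<Longrightarrow> card (A j) \<le> 3"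
  shows "card (parity_clauses m A \<beta>) \<le> 8 * m"
proof -
  let ?B = "\<lambda>j. (\<lambda>S. (\<lambda>x. (x, x \<in> S)) ` A j) ` Pow (A j)"
  have B: "finite (\<Union>j<m. ?B j)" using fin by auto
  have "card (parity_clauses m A \<beta>) \<le> card (\<Union>j<m. ?B j)"
    by (intro card_mono B parity_clauses_subset_Union)
  also have "\<dots> \<le> (\<Sum>j<m. card (?B j))"
    by (intro card_UN_le) auto
  also have "\<dots> \<le> (\<Sum>j<m. 8)"
  proof (intro sum_mono)
    fix j assume "j \<in> {..<m}"
    then have j: "j < m" by simp
    have "card (?B j) \<le> card (Pow (A j))"
      using fin[OF j] by (intro card_image_le) auto
    also have "\<dots> = 2 ^ card (A j)" using fin[OF j] by (simp add: card_Pow)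
    also have "\<dots> \<le> 2 ^ 3" using three[OF j] by (intro power_increasing) auto
    finally show "card (?B j) \<le> 8" by simp
  qed
  finally show "card (parity_clauses m A \<beta>) \<le> 8 * m" by simp
qed

section \<open>Flipping literals across the disjoint union\<close>

definition flip_lit :: "(nat \<Rightarrow> bool) \<Rightarrow> literal \<Rightarrow> literal" where
  "flip_lit g l = (fst l, snd l \<noteq> g (fst l))"

fun flip_vertex :: "(nat \<Rightarrow> bool) \<Rightarrow> lcn_vertex \<Rightarrow> lcn_vertex" where
  "flip_vertex g (LitV l) = LitV (flip_lit g l)"
| "flip_vertex g (ClauseV c) = ClauseV (flip_lit g ` c)"

fun vertex_vars :: "lcn_vertex \<Rightarrow> nat set" where
  "vertex_vars (LitV l) = {fst l}"
| "vertex_vars (ClauseV c) = fst ` c"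

text \<open>Exchanging the two copies makes the flip an involution of the disjoint union, so one map
  serves both directions of a bijection.\<close>

fun swap_flip :: "(nat \<Rightarrow> bool) \<Rightarrow> lcn_vertex + lcn_vertex \<Rightarrow> lcn_vertex + lcn_vertex" where
  "swap_flip g (Inl v) = Inr (flip_vertex g v)"
| "swap_flip g (Inr v) = Inl (flip_vertex g v)"

fun sum_vars :: "lcn_vertex + lcn_vertex \<Rightarrow> nat set" where
  "sum_vars (Inl v) = vertex_vars v"
| "sum_vars (Inr v) = vertex_vars v"

lemma fst_flip_lit [simp]: "fst (flip_lit g l) = fst l"
  by (simp add: flip_lit_def)

lemma flip_lit_flip_lit [simp]: "flip_lit g (flip_lit g l) = l"
  by (cases l) (auto simp: flip_lit_def)

lemma inj_flip_lit: "inj (flip_lit g)"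
  by (metis injI flip_lit_flip_lit)

lemma flip_vertex_flip_vertex [simp]: "flip_vertex g (flip_vertex g v) = v"
  by (cases v) (auto simp: image_image)

lemma swap_flip_swap_flip [simp]: "swap_flip g (swap_flip g v) = v"
  by (cases v) auto

lemma sum_vars_swap_flip [simp]: "sum_vars (swap_flip g v) = sum_vars v"
proof -
  have "vertex_vars (flip_vertex g w) = vertex_vars w" for w
    by (cases w) (auto simp: image_image)
  then show ?thesis by (cases v) auto
qed

lemma swap_flip_cong:
  assumes "\<And>x. x \<in> sum_vars v \<Longrightarrow> g x = g' x"
  shows "swap_flip g v = swap_flip g' v"
proof -
  have "flip_vertex g w = flip_vertex g' w" if "\<And>x. x \<in> vertex_vars w \<Longrightarrow> g x = g' x" for w
    using that by (cases w) (auto simp: flip_lit_def intro!: image_cong)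
  then show ?thesis using assms by (cases v) auto
qed

text \<open>Both literals of a variable are flipped together, and injectivity of the flip preserves
  membership in clauses.\<close>

lemma lcn_E_flip_vertex: "lcn_E (flip_vertex g v) (flip_vertex g w) = lcn_E v w"
proof (cases "(v, w)" rule: lcn_E.cases)
  case (3 i b j b')
  then show ?thesis by (auto simp: flip_lit_def)
qed (auto simp: inj_image_mem_iff[OF inj_flip_lit])

lemma union_E_swap_flip:
  "union_E lcn_E lcn_E (swap_flip g v) (swap_flip g w) = union_E lcn_E lcn_E v w"
  by (cases v; cases w) (auto simp: lcn_E_flip_vertex)

lemma same_atp_map_swap_flip: "same_atp (union_E lcn_E lcn_E) vs (map (swap_flip g) vs)"
  unfolding same_atp_def by (auto simp: union_E_swap_flip) (metis swap_flip_swap_flip)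

lemma LitV_in_lcn_V [simp]: "LitV l \<in> lcn_V N F \<longleftrightarrow> fst l < N"
  by (cases l) (auto simp: lcn_V_def)

lemma ClauseV_in_lcn_V [simp]: "ClauseV c \<in> lcn_V N F \<longleftrightarrow> c \<in> F"
  by (auto simp: lcn_V_def)

text \<open>Flipping by \<open>g\<close> adds \<open>g\<close> to the falsifying assignment, which
  shifts its parity by the sum of \<open>g\<close> over \<open>A j\<close>.\<close>

lemma flip_clause_in_parity_clauses:
  assumes "inj_on fst c" "fst ` c = A j" "j < m" "(\<Sum>l\<in>c. of_bool (\<not> snd l)) \<noteq> \<beta> j"
    and shift: "\<beta>' j = \<beta> j + (\<Sum>x\<in>A j. of_bool (g x))"
  shows "flip_lit g ` c \<in> parity_clauses m A \<beta>'"
proof -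
  have inj: "inj_on (flip_lit g) c"
    using inj_flip_lit inj_on_subset by blast
  have "(\<Sum>l\<in>flip_lit g ` c. of_bool (\<not> snd l)) = (\<Sum>l\<in>c. of_bool (\<not> snd l) + of_bool (g (fst l)) :: bit)"
    unfolding sum.reindex[OF inj] by (intro sum.cong) (auto simp: flip_lit_def)
  also have "\<dots> = (\<Sum>l\<in>c. of_bool (\<not> snd l)) + (\<Sum>x\<in>A j. of_bool (g x))"
    using assms(1,2) by (simp add: sum.distrib sum.reindex flip: assms(2))
  finally have "(\<Sum>l\<in>flip_lit g ` c. of_bool (\<not> snd l)) \<noteq> \<beta>' j"
    using assms(4) unfolding shift by simp
  moreover have "inj_on fst (flip_lit g ` c)"
    using assms(1) by (auto simp: inj_on_def)
  moreover have "fst ` flip_lit g ` c = A j"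
    using assms(2) by (simp add: image_image)
  ultimately show ?thesis
    using assms(3) unfolding parity_clauses_def by blast
qed

section \<open>Duplicator's strategy on the disjoint union\<close>

context expanding_system
begin

abbreviation (input) "V\<^sub>0 \<equiv> lcn_V N (parity_clauses m A (\<lambda>_. 0))"
abbreviation (input) "V\<^sub>b \<equiv> lcn_V N (parity_clauses m A b)"

lemma finite_A: "j < m \<Longrightarrow> finite (A j)"
  using A_subset finite_subset by blast

lemma sum_vars_small:
  assumes "v \<in> V\<^sub>0 <+> V\<^sub>b"
  shows "finite (sum_vars v)" "card (sum_vars v) \<le> 3"
proof -
  have "finite (vertex_vars w) \<and> card (vertex_vars w) \<le> 3" if "w \<in> V\<^sub>0 \<union> V\<^sub>b" for w
    using that finite_A card_A unfolding lcn_V_def parity_clauses_def by fastforce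
  then show "finite (sum_vars v)" "card (sum_vars v) \<le> 3" using assms by auto
qed

text \<open>On equations inside \<open>T\<close> a good \<open>g\<close> solves the system with
  right-hand side \<open>b\<close>, so flipping adds \<open>b j\<close> to the right-hand side. This
  carries 0 to \<open>b\<close> and, in characteristic 2, \<open>b\<close> back to 0.\<close>

lemma swap_flip_in:
  assumes "v \<in> V\<^sub>0 <+> V\<^sub>b" "good T g" "sum_vars v \<subseteq> T" "1 \<le> s"
  shows "swap_flip g v \<in> V\<^sub>0 <+> V\<^sub>b"
proof -
  have clause: "flip_lit g ` c \<in> parity_clauses m A \<beta>'"
    if c: "c \<in> parity_clauses m A \<beta>" "fst ` c \<subseteq> T" and shift: "\<And>j. \<beta>' j = \<beta> j + b j" for c \<beta> \<beta>'
  proof -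
    obtain j where j: "j < m" "inj_on fst c" "fst ` c = A j" "(\<Sum>l\<in>c. of_bool (\<not> snd l)) \<noteq> \<beta> j"
      using c unfolding parity_clauses_def by blast
    have "b j = (\<Sum>x \<in> A j. of_bool (g x))"
      using good_equation[OF assms(2) j(1)] assms c j by simp
    then show ?thesis
      using j shift by (intro flip_clause_in_parity_clauses) auto
  qed
  show ?thesis
  proof (cases v)
    case (Inl w)
    then show ?thesis
      using assms(1,3) clause[of _ "\<lambda>_. 0" b] by (cases w) auto
  next
    case (Inr w)
    then show ?thesis
      using assms(1,3) clause[of _ b "\<lambda>_. 0"] by (cases w) auto
  qed
qed

definition tuple_vars :: "(lcn_vertex + lcn_vertex) list \<Rightarrow> nat set" where
  "tuple_vars vs = (\<Union>v\<in>set vs. sum_vars v)"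

lemma tuple_vars_map_swap_flip [simp]: "tuple_vars (map (swap_flip g) vs) = tuple_vars vs"
  by (simp add: tuple_vars_def)

text \<open>Duplicator's invariant. The assignment is quantified existentially because it may change
  whenever a pebble moves.\<close>

definition position :: "nat \<Rightarrow> ((lcn_vertex + lcn_vertex) list \<times> (lcn_vertex + lcn_vertex) list) set" where
  "position k = {(vs, us). vs \<in> tuples k (V\<^sub>0 <+> V\<^sub>b) \<and> (\<exists>g. good (tuple_vars vs) g \<and> us = map (swap_flip g) vs)}"

lemma card_UN_sum_vars_le:
  assumes "finite I" "\<And>i. i \<in> I \<Longrightarrow> h i \<in> V\<^sub>0 <+> V\<^sub>b"
  shows "finite (\<Union>i\<in>I. sum_vars (h i))" "card (\<Union>i\<in>I. sum_vars (h i)) \<le> 3 * card I"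
proof -
  show "finite (\<Union>i\<in>I. sum_vars (h i))"
    using assms sum_vars_small by blast
  have "card (\<Union>i\<in>I. sum_vars (h i)) \<le> (\<Sum>i\<in>I. card (sum_vars (h i)))"
    by (intro card_UN_le assms)
  also have "\<dots> \<le> (\<Sum>i\<in>I. 3)"
    using assms sum_vars_small by (intro sum_mono) auto
  finally show "card (\<Union>i\<in>I. sum_vars (h i)) \<le> 3 * card I" by simp
qed

lemma map_swap_flip_in_tuples:
  assumes "vs \<in> tuples k (V\<^sub>0 <+> V\<^sub>b)" "good (tuple_vars vs) g" "1 \<le> s"
  shows "map (swap_flip g) vs \<in> tuples k (V\<^sub>0 <+> V\<^sub>b)"
proof -
  have "swap_flip g v \<in> V\<^sub>0 <+> V\<^sub>b" if "v \<in> set vs" for v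
    using that assms by (intro swap_flip_in) (auto simp: tuples_def tuple_vars_def)
  then show ?thesis using assms(1) by (auto simp: tuples_def)
qed

text \<open>Lifting pebble \<open>i\<close> leaves at most \<open>3 * (k - 1)\<close> variables
  fixed, and a new vertex brings at most 3, so an extension exists within the budget
  \<open>6 * k\<close>. It agrees with the old assignment on the remaining pebbles, whose images
  therefore stay put.\<close>

lemma position_move:
  assumes pos: "(vs, us) \<in> position k" and i: "i < k" and s: "6 * k \<le> s"
  shows "\<exists>\<pi>. bij_betw \<pi> (V\<^sub>0 <+> V\<^sub>b) (V\<^sub>0 <+> V\<^sub>b) \<and>
    (\<forall>w \<in> V\<^sub>0 <+> V\<^sub>b. (vs[i := w], us[i := \<pi> w]) \<in> position k)"
proof -
  let ?V = "V\<^sub>0 <+> V\<^sub>b"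
  obtain g where vs: "vs \<in> tuples k ?V" and g: "good (tuple_vars vs) g" and us: "us = map (swap_flip g) vs"
    using pos unfolding position_def by blast
  have len: "length vs = k" and inV: "\<And>j. j < k \<Longrightarrow> vs ! j \<in> ?V"
    using vs by (auto simp: tuples_def)
  let ?T = "\<Union>j\<in>{..<k} - {i}. sum_vars (vs ! j)"
  have finT: "finite ?T" and "card ?T \<le> 3 * card ({..<k} - {i})"
    using card_UN_sum_vars_le[of "{..<k} - {i}" "\<lambda>j. vs ! j"] inV by auto
  then have cardT: "card ?T \<le> 3 * (k - 1)" using i by simp
  have "?T \<subseteq> tuple_vars vs"
    using len by (auto simp: tuple_vars_def)
  then have gT: "good ?T g" using g good_mono by blast
  \<comment> \<open>The side conditions sit under the quantifier so that the extension can be chosen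
    as a function of the variable set alone.\<close>
  have "\<exists>g'. (finite I \<and> card I \<le> 3 \<longrightarrow> (\<forall>y\<in>?T. g' y = g y) \<and> good (?T \<union> I) g')" for I
    using good_union[OF _ gT finT, of I] cardT i s by auto
  then obtain G where G: "\<And>I. finite I \<Longrightarrow> card I \<le> 3 \<Longrightarrow>
      (\<forall>y\<in>?T. G I y = g y) \<and> good (?T \<union> I) (G I)"
    by metis
  have Gv: "\<And>y. y \<in> ?T \<Longrightarrow> G (sum_vars w) y = g y" "good (?T \<union> sum_vars w) (G (sum_vars w))"
    if "w \<in> ?V" for w
    using G[of "sum_vars w"] sum_vars_small[OF that] by auto
  \<comment> \<open>\<open>\<pi>\<close> is an involution because the assignment depends on the vertex only through its variable set,
      which \<^const>\<open>swap_flip\<close> preserves.\<close>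
  define \<pi> where "\<pi> w = swap_flip (G (sum_vars w)) w" for w
  have pi_in: "\<pi> w \<in> ?V" if "w \<in> ?V" for w
    unfolding \<pi>_def using swap_flip_in[OF that Gv(2)[OF that]] s i by auto
  have "\<pi> (\<pi> w) = w" for w
    by (simp add: \<pi>_def)
  then have "bij_betw \<pi> ?V ?V"
    using pi_in by (intro bij_betw_byWitness[where f' = \<pi>]) auto
  moreover have "(vs[i := w], us[i := \<pi> w]) \<in> position k" if w: "w \<in> ?V" for w
  proof -
    have "us[i := \<pi> w] = map (swap_flip (G (sum_vars w))) (vs[i := w])"
    proof (rule nth_equalityI)
      fix j assume "j < length (us[i := \<pi> w])"
      then have j: "j < k" by (simp add: us len)
      show "us[i := \<pi> w] ! j = map (swap_flip (G (sum_vars w))) (vs[i := w]) ! j"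
      proof (cases "j = i")
        case True
        then show ?thesis using j by (simp add: us len \<pi>_def)
      next
        case False
        then have "swap_flip g (vs ! j) = swap_flip (G (sum_vars w)) (vs ! j)"
          using Gv(1)[OF w] j by (intro swap_flip_cong) auto
        then show ?thesis using j False by (simp add: us len)
      qed
    qed (simp add: us)
    moreover have "tuple_vars (vs[i := w]) \<subseteq> ?T \<union> sum_vars w"
    proof
      fix x assume "x \<in> tuple_vars (vs[i := w])"
      then obtain j where "j < k" "x \<in> sum_vars (vs[i := w] ! j)"
        by (auto simp: tuple_vars_def in_set_conv_nth len)
      then show "x \<in> ?T \<union> sum_vars w"
        by (cases "j = i") (auto simp: len)
    qed
    then have "good (tuple_vars (vs[i := w])) (G (sum_vars w))"
      using Gv(2)[OF w] good_mono by blast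
    moreover have "vs[i := w] \<in> tuples k ?V"
      using vs w by (auto simp: tuples_def dest: set_update_subset_insert[THEN subsetD])
    ultimately show ?thesis unfolding position_def by blast
  qed
  ultimately show ?thesis by blast
qed

text \<open>Each tuple is matched with a flipped tuple of the same stable colour. The matching is an
  involution exchanging the tuples of the two graphs, so every colour occurs equally often in
  both.\<close>

lemma wl_indistinguishable_parity_clauses:
  assumes k: "1 \<le> k" and s: "6 * k \<le> s"
  shows "wl_indistinguishable k V\<^sub>0 lcn_E V\<^sub>b lcn_E"
proof -
  let ?V = "V\<^sub>0 <+> V\<^sub>b"
  let ?E = "union_E lcn_E lcn_E"
  let ?R = "wl_stable k ?V ?E"
  have s1: "1 \<le> s" using k s by simp
  have equiv: "equiv (tuples k ?V) ?R"
    unfolding wl_stable_def by (rule equiv_wl_rel)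
  have sub: "position k \<subseteq> ?R"
    unfolding wl_stable_def
  proof (rule bisimulation_subset_wl_rel)
    fix vs us assume "(vs, us) \<in> position k"
    then show "vs \<in> tuples k ?V \<and> us \<in> tuples k ?V \<and> same_atp ?E vs us"
      using map_swap_flip_in_tuples s1 same_atp_map_swap_flip unfolding position_def by blast
  qed (use position_move s in blast)
  \<comment> \<open>A good assignment is built up from the empty set; a \<open>k\<close>-tuple
    involves at most \<open>3 * k\<close> variables.\<close>
  have "\<exists>g. finite T \<and> card T \<le> 3 * k \<longrightarrow> good T g" for T
    using good_union[of T "{}", OF _ good_empty] s by fastforce
  then obtain G where G: "\<And>T. finite T \<Longrightarrow> card T \<le> 3 * k \<Longrightarrow> good T (G T)"
    by metis
  have Gt: "good (tuple_vars t) (G (tuple_vars t))" if t: "t \<in> tuples k ?V" for t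
  proof -
    have "finite (tuple_vars t)" "card (tuple_vars t) \<le> 3 * card (set t)"
      using t card_UN_sum_vars_le[of "set t" id] by (auto simp: tuple_vars_def tuples_def)
    moreover have "card (set t) \<le> k"
      using t card_length[of t] by (auto simp: tuples_def)
    ultimately show ?thesis by (intro G) auto
  qed
  \<comment> \<open>The assignment depends on \<open>t\<close> only through
    \<open>tuple_vars t\<close>, which flipping preserves; hence \<open>\<Phi>\<close> is an
    involution.\<close>
  define \<Phi> where "\<Phi> t = map (swap_flip (G (tuple_vars t))) t" for t
  have invol: "\<Phi> (\<Phi> t) = t" for t
    by (simp add: \<Phi>_def o_def)
  have rel: "(t, \<Phi> t) \<in> ?R" if "t \<in> tuples k ?V" for t
    using that Gt[OF that] sub unfolding position_def \<Phi>_def by blast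
  have "card (C \<inter> tuples k (Inl ` V\<^sub>0)) = card (C \<inter> tuples k (Inr ` V\<^sub>b))"
    if C: "C \<in> tuples k ?V // ?R" for C
  proof -
    have stay: "\<Phi> t \<in> C" if "t \<in> C" "t \<in> tuples k ?V" for t
      using in_quotient_imp_closed[OF equiv C that(1) rel[OF that(2)]] .
    have in_V: "\<Phi> t \<in> tuples k ?V" if "t \<in> tuples k ?V" for t
      using rel[OF that] equiv by (auto simp: equiv_def)
    have swap: "\<Phi> t \<in> tuples k (Inr ` V\<^sub>b) \<and> t \<in> tuples k ?V" if "t \<in> tuples k (Inl ` V\<^sub>0)" for t
    proof -
      have t: "t \<in> tuples k ?V" using that by (auto simp: tuples_def)
      have "v \<in> Inr ` V\<^sub>b" if v: "v \<in> set (\<Phi> t)" for v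
      proof -
        have "v \<in> range Inr"
          using v \<open>t \<in> tuples k (Inl ` V\<^sub>0)\<close> by (fastforce simp: \<Phi>_def tuples_def)
        moreover have "v \<in> ?V" using v in_V[OF t] by (auto simp: tuples_def)
        ultimately show ?thesis by auto
      qed
      then show ?thesis using t in_V[OF t] by (auto simp: tuples_def)
    qed
    have swap': "\<Phi> t \<in> tuples k (Inl ` V\<^sub>0) \<and> t \<in> tuples k ?V" if "t \<in> tuples k (Inr ` V\<^sub>b)" for t
    proof -
      have t: "t \<in> tuples k ?V" using that by (auto simp: tuples_def)
      have "v \<in> Inl ` V\<^sub>0" if v: "v \<in> set (\<Phi> t)" for v
      proof -
        have "v \<in> range Inl"
          using v \<open>t \<in> tuples k (Inr ` V\<^sub>b)\<close> by (fastforce simp: \<Phi>_def tuples_def)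
        moreover have "v \<in> ?V" using v in_V[OF t] by (auto simp: tuples_def)
        ultimately show ?thesis by auto
      qed
      then show ?thesis using t in_V[OF t] by (auto simp: tuples_def)
    qed
    have "bij_betw \<Phi> (C \<inter> tuples k (Inl ` V\<^sub>0)) (C \<inter> tuples k (Inr ` V\<^sub>b))"
      using stay swap swap' invol by (intro bij_betw_byWitness[where f' = \<Phi>]) auto
    then show ?thesis by (rule bij_betw_same_card)
  qed
  then show ?thesis
    unfolding wl_indistinguishable_def Let_def by blast
qed

end

section \<open>Choice of parameters\<close>

theorem theorem2:
  shows "\<exists>C::real. C > 0 \<and> (\<forall>n::nat. n \<ge> 1 \<longrightarrow>
    (\<exists>N F N' F'. is_3sat N F \<and> is_3sat N' F' \<and>
       real N \<le> C * real n \<and> real (card F) \<le> C * real n \<and>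
       real N' \<le> C * real n \<and> real (card F') \<le> C * real n \<and>
       satisfiable F \<and> \<not> satisfiable F' \<and>
       wl_indistinguishable n (lcn_V N F) lcn_E (lcn_V N' F') lcn_E))"
proof (intro exI[of _ "16 * real (432 ^ 4 * 24)"] conjI allI impI)
  \<comment> \<open>The game needs \<open>s = 6 * n\<close> and expansion needs \<open>N\<close> to
    be at least \<open>432 ^ 4 * (4 * s)\<close>, whence 24. With 8 clauses per equation and
    \<open>N + 1\<close> equations, the factor 16 suffices.\<close>
  let ?d = "432 ^ 4 * 24 :: nat"
  show "16 * real ?d > 0" by simp
  fix n :: nat assume n: "n \<ge> 1"
  define N where "N = ?d * n"
  \<comment> \<open>One equation more than variables already leaves some right-hand side
    unreachable.\<close>
  define m where "m = N + 1"
  have N1: "1 \<le> N" using n by (simp add: N_def)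
  obtain A where "expanding_system N m (6 * n) A"
    using expanding_system_exists[of "6 * n" m N] n N1 by (auto simp: N_def m_def)
  \<comment> \<open>The interpretation is generic in \<open>b\<close>, since the unreachable
    right-hand side is found only afterwards.\<close>
  then interpret expanding_system N m "6 * n" A b for b .
  obtain b where b: "\<not> (\<exists>\<sigma>. \<forall>j<m. (\<Sum>x\<in>A j. of_bool (\<sigma> x)) = (b j :: bit))"
    using unsatisfiable_rhs_exists[of m A N] A_subset by (auto simp: m_def)
  let ?F = "parity_clauses m A"
  have sat3: "is_3sat N (?F \<beta>)" for \<beta>
    using A_subset card_A by (intro is_3sat_parity_clauses)
  have "8 * m \<le> 16 * ?d * n"
    using N1 by (simp add: m_def N_def)
  then have "card (?F \<beta>) \<le> 16 * ?d * n" for \<beta>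
    using card_parity_clauses[of m A \<beta>] finite_A card_A by (meson order_trans)
  then have card_F: "real (card (?F \<beta>)) \<le> 16 * real ?d * real n" for \<beta>
    using of_nat_mono[of "card (?F \<beta>)" "16 * ?d * n", where 'a = real] by simp
  have card_N: "real N \<le> 16 * real ?d * real n"
    by (simp add: N_def)
  have "\<exists>\<sigma>. \<forall>j<m. (\<Sum>x\<in>A j. of_bool (\<sigma> x)) = (0 :: bit)"
    by (intro exI[of _ "\<lambda>_. False"]) simp
  then have "satisfiable (?F (\<lambda>_. 0))" "\<not> satisfiable (?F b)"
    using b satisfiable_parity_clauses[of m A] finite_A by auto
  moreover have "wl_indistinguishable n (lcn_V N (?F (\<lambda>_. 0))) lcn_E (lcn_V N (?F b)) lcn_E"
    using n by (intro wl_indistinguishable_parity_clauses) auto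
  ultimately show "\<exists>N F N' F'. is_3sat N F \<and> is_3sat N' F' \<and>
       real N \<le> 16 * real ?d * real n \<and> real (card F) \<le> 16 * real ?d * real n \<and>
       real N' \<le> 16 * real ?d * real n \<and> real (card F') \<le> 16 * real ?d * real n \<and>
       satisfiable F \<and> \<not> satisfiable F' \<and>
       wl_indistinguishable n (lcn_V N F) lcn_E (lcn_V N' F') lcn_E"
    using sat3 card_F card_N by blast
qed

end
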